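(* Let $d=2$ and let $\psi\in\Psi$. There exists a constant $C_*>0$ such that for every $n\in\mathbb{N}$ $$\inf_{\bar{\boldsymbol f}_n}\ \sup_{\boldsymbol f_*\in\mathcal{F}^{\mathrm L}_{\mathrm{INV}}}\ \mathsf{R}_{\mathrm{INV}}(\bar{\boldsymbol f}_n,\boldsymbol f_* )\ \ge\ C_*\,n^{-2/(2+d)},$$ where the infimum is over all measurable estimators $\bar{\boldsymbol f}_n$ depending on the sample $\mathcal{D}_n$.
   Context: Let $d=2$ and $I=[-1,1]$. $\mathcal{F}^{\mathrm L}_{\mathrm{INV}}$ is the set of bijections $\boldsymbol f:I^2\to I^2$ that are bi-Lipschitz, i.e. there is some $L\ge 1$ with $L^{-1}\|\boldsymbol x-\boldsymbol x'\|_2\le\|\boldsymbol f(\boldsymbol x)-\boldsymbol f(\boldsymbol x')\|_2\le L\|\boldsymbol x-\boldsymbol x'\|_2$ for all $\boldsymbol x,\boldsymbol x'\in I^2$. Model: $\mathcal{D}_n=\{(\boldsymbol X_i,\boldsymbol Y_i)\}_{i=1}^n\subset I^2\times\mathbb{R}^2$ are i.i.d. with $\boldsymbol Y_i=\boldsymbol f_*(\boldsymbol X_i)+\boldsymbol\varepsilon_i$, $\boldsymbol\varepsilon_i\sim N_2(\boldsymbol 0,\sigma^2\boldsymbol I_2)$ i.i.d., $\sigma^2>0$ fixed, $\boldsymbol f_*\in\mathcal{F}^{\mathrm L}_{\mathrm{INV}}$ the true function. The (fixed) marginal distribution $P_{\boldsymbol X}$ of $\boldsymbol X_i$ has a density that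 is positive and bounded on $I^2$. $\mathbb{E}_n$ is expectation with respect to $\mathcal{D}_n$. An estimator $\bar{\boldsymbol f}_n$ is a measurable function of $\mathcal{D}_n$ with values in (measurable) maps $I^2\to\mathbb{R}^2$. Its quasi-inverse $\bar{\boldsymbol f}_n^{\ddagger}:I^2\to\mathbb{R}^2$ is: $\bar{\boldsymbol f}_n^{\ddagger}(\boldsymbol y)=\boldsymbol x$ if $\boldsymbol x\in I^2$ is the unique point with $\bar{\boldsymbol f}_n(\boldsymbol x)=\boldsymbol y$, and $\bar{\boldsymbol f}_n^{\ddagger}(\boldsymbol y)=\boldsymbol c$ if no unique such point exists, where $\boldsymbol c\in\mathbb{R}^2\setminus I^2$ is a fixed vector. For $\boldsymbol f=(f_1,f_2)$, $\|\boldsymbol f\|_{L^2(P_{\boldsymbol X})}=(\sum_{j=1}^2\int|f_j|^2\,dP_{\boldsymbol X})^{1/2}$. $\Psi$ is the set of continuous increasing functions $\psi:\mathbb{R}_{\ge0}\to\mathbb{R}_{\ge0}$ with $\psi(0)=0$. The inverse risk is $$\mathsf{R}_{\mathrm{INV}}(\bar{\boldsymbol f}_n,\boldsymbol f_* )=\mathbb{E}_n\Big[\|\bar{\boldsymbol f}_n-\boldsymbol f_*\|_{L^2(P_{\boldsymbol X})}^2+\psi\big(\|\bar{\boldsymbol f}_n^{\ddagger}-\boldsymbol f_*^{-1}\|_{L^2(P_{\boldsymbol X})}\big)\Big].$$ *)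

theory Defs
  imports "HOL-Probability.Probability"
begin

definition I2 :: "(real^2) set" where
  "I2 = {x. \<forall>j. x $ j \<in> {-1..1}}"

(* Functions are total on real^2 in HOL; only their restriction to I2 matters throughout. *)
definition F_INV :: "(real^2 \<Rightarrow> real^2) set" where
  "F_INV = {f. bij_betw f I2 I2 \<and>
     (\<exists>L\<ge>1. \<forall>x\<in>I2. \<forall>x'\<in>I2.
        inverse L * norm (x - x') \<le> norm (f x - f x') \<and>
        norm (f x - f x') \<le> L * norm (x - x'))}"

definition Psi :: "(real \<Rightarrow> real) set" where
  "Psi = {\<psi>. continuous_on {0..} \<psi> \<and> mono_on {0..} \<psi> \<and> \<psi> ` {0..} \<subseteq> {0..} \<and> \<psi> 0 = 0}"

(* The space of the measure P is the square itself, not the whole plane. *)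
definition positive_bounded_density :: "(real^2) measure \<Rightarrow> bool" where
  "positive_bounded_density P \<longleftrightarrow>
     (\<exists>p B. p \<in> borel_measurable (restrict_space borel I2) \<and>
        (\<forall>x\<in>I2. 0 < p x \<and> p x \<le> (B::real)) \<and>
        P = density (restrict_space lborel I2) (\<lambda>x. ennreal (p x)))"

(* The centred Gaussian law on the plane with covariance matrix \<sigma>^2 times the identity;
   normal_density takes the standard deviation. *)
definition noise_law :: "real \<Rightarrow> (real^2) measure" where
  "noise_law \<sigma> = density lborel (\<lambda>e. ennreal (\<Prod>j\<in>UNIV. normal_density 0 \<sigma> (e $ j)))"

definition obs_space :: "((real^2) \<times> (real^2)) measure" where
  "obs_space = restrict_space borel I2 \<Otimes>\<^sub>M borel"

definition obs_law :: "(real^2) measure \<Rightarrow> real \<Rightarrow> (real^2 \<Rightarrow> real^2) \<Rightarrow> ((real^2) \<times> (real^2)) measure" where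
  "obs_law P \<sigma> f = distr (P \<Otimes>\<^sub>M noise_law \<sigma>) obs_space (\<lambda>(x, e). (x, f x + e))"

definition data_space :: "nat \<Rightarrow> (nat \<Rightarrow> (real^2) \<times> (real^2)) measure" where
  "data_space n = PiM {..<n} (\<lambda>_. obs_space)"

definition data_law ::
    "(real^2) measure \<Rightarrow> real \<Rightarrow> nat \<Rightarrow> (real^2 \<Rightarrow> real^2) \<Rightarrow> (nat \<Rightarrow> (real^2) \<times> (real^2)) measure" where
  "data_law P \<sigma> n f = PiM {..<n} (\<lambda>_. obs_law P \<sigma> f)"

(* Joint measurability in the data and the evaluation point. *)
definition estimators :: "nat \<Rightarrow> ((nat \<Rightarrow> (real^2) \<times> (real^2)) \<Rightarrow> real^2 \<Rightarrow> real^2) set" where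
  "estimators n =
     {fbar. (\<lambda>(D, x). fbar D x) \<in> borel_measurable (data_space n \<Otimes>\<^sub>M restrict_space borel I2)}"

definition quasi_inverse :: "real^2 \<Rightarrow> (real^2 \<Rightarrow> real^2) \<Rightarrow> real^2 \<Rightarrow> real^2" where
  "quasi_inverse c f y =
     (if \<exists>!x. x \<in> I2 \<and> f x = y then THE x. x \<in> I2 \<and> f x = y else c)"

(* The squared norm takes values in ennreal, since an estimator need not be square integrable. *)
definition L2_norm_sq :: "(real^2) measure \<Rightarrow> (real^2 \<Rightarrow> real^2) \<Rightarrow> ennreal" where
  "L2_norm_sq P f = (\<Sum>j\<in>UNIV. \<integral>\<^sup>+ x. ennreal (\<bar>f x $ j\<bar>\<^sup>2) \<partial>P)"

(* The argument of \<psi> is a genuine real number: on I2, the quasi-inverse takes values in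
   insert c I2 and the inverse of f takes values in I2, so enn2real never meets infinity.
   A quasi-inverse of a Borel map is measurable in general only with respect to the
   completion; this is harmless because nn_integral does not change under completion. *)
definition inverse_risk ::
    "(real^2) measure \<Rightarrow> real \<Rightarrow> real^2 \<Rightarrow> (real \<Rightarrow> real) \<Rightarrow> nat \<Rightarrow>
     ((nat \<Rightarrow> (real^2) \<times> (real^2)) \<Rightarrow> real^2 \<Rightarrow> real^2) \<Rightarrow> (real^2 \<Rightarrow> real^2) \<Rightarrow> ennreal" where
  "inverse_risk P \<sigma> c \<psi> n fbar f =
     (\<integral>\<^sup>+ D. L2_norm_sq P (\<lambda>x. fbar D x - f x) +
        ennreal (\<psi> (sqrt (enn2real
          (L2_norm_sq P (\<lambda>y. quasi_inverse c (fbar D) y - inv_into I2 f y)))))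
      \<partial>data_law P \<sigma> n f)"

end

theory Submission
  imports Defs
begin

text \<open>
  Already the regression part of the risk has the claimed lower bound. Cut \<open>I2\<close> into
  \<open>m\<^sup>2\<close> squares with \<open>m\<close> of order \<open>n powr (1/4)\<close>. For a set \<open>S\<close> of squares move every point
  of those squares horizontally by a small pyramid-shaped bump; the bumps have Lipschitz constant
  1/2 and vanish on the boundary, so the resulting map is a bi-Lipschitz bijection of \<open>I2\<close>.
  Adding one square to \<open>S\<close> yields a likelihood ratio whose second moment is bounded uniformly
  in \<open>n\<close>, so the two data laws cannot be told apart and an estimator errs by a
  multiple of the squared bump for one of them. This is averaged over all \<open>S\<close> separately at each
  point \<open>x\<close> (Assouad's argument, applied to the square containing \<open>x\<close>) and then integrated
  over \<open>x\<close>. The design density need not be bounded away from zero; it suffices that a set of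
  Lebesgue measure at least 1 in \<open>I2\<close> has design probability bounded below.
\<close>

section \<open>Sums and product measures\<close>

text \<open>The pairing behind Assouad's argument: every set of squares without \<open>k\<close> is
  matched with the same set enlarged by \<open>k\<close>.\<close>

lemma sum_Pow_insert:
  fixes F :: "'b set \<Rightarrow> 'c::comm_monoid_add"
  assumes "finite A" "k \<notin> A"
  shows "sum F (Pow (insert k A)) = (\<Sum>S\<in>Pow A. F S + F (insert k S))"
proof -
  have "inj_on (insert k) (Pow A)"
    using assms(2) by (auto simp: inj_on_def)
  moreover have "Pow A \<inter> insert k ` Pow A = {}"
    using assms(2) by auto
  ultimately show ?thesis
    using assms(1) by (simp add: Pow_insert sum.union_disjoint sum.reindex sum.distrib)
qed

lemma measurable_vec_component [measurable (raw)]: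
  fixes f :: "'a \<Rightarrow> real^'n"
  shows "f \<in> borel_measurable M \<Longrightarrow> (\<lambda>x. f x $ i) \<in> borel_measurable M"
  by (rule measurable_compose[of f M borel "\<lambda>v. v $ i"])
    (auto intro!: borel_measurable_continuous_onI continuous_intros)

text \<open>A sigma-finite product measure is determined by its values on boxes. On a box the
  indicator is a product over the coordinates, so the integral of the product density
  factorises.\<close>

lemma PiM_density:
  fixes f :: "'i \<Rightarrow> 'a \<Rightarrow> ennreal"
  assumes I: "finite I"
    and M: "\<And>i. sigma_finite_measure (M i)"
    and f [measurable]: "\<And>i. f i \<in> borel_measurable (M i)"
    and D: "\<And>i. sigma_finite_measure (density (M i) (f i))"
  shows "PiM I (\<lambda>i. density (M i) (f i)) = density (PiM I M) (\<lambda>x. \<Prod>i\<in>I. f i (x i))"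
proof -
  interpret M: product_sigma_finite M by (rule product_sigma_finite.intro) fact
  interpret D: product_sigma_finite "\<lambda>i. density (M i) (f i)" by (rule product_sigma_finite.intro) fact
  show ?thesis
  proof (rule D.PiM_eqI[symmetric, OF I])
    show "sets (density (PiM I M) (\<lambda>x. \<Prod>i\<in>I. f i (x i))) = sets (PiM I (\<lambda>i. density (M i) (f i)))"
      by (simp cong: sets_PiM_cong)
  next
    fix A assume "\<And>i. i \<in> I \<Longrightarrow> A i \<in> sets (density (M i) (f i))"
    then have A [measurable]: "A i \<in> sets (M i)" if "i \<in> I" for i using that by simp
    have [measurable]: "(\<lambda>x. \<Prod>i\<in>I. f i (x i)) \<in> borel_measurable (PiM I M)"
      by measurable
    have "emeasure (density (PiM I M) (\<lambda>x. \<Prod>i\<in>I. f i (x i))) (PiE I A)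
        = (\<integral>\<^sup>+x. (\<Prod>i\<in>I. f i (x i)) * indicator (PiE I A) x \<partial>PiM I M)"
      using I A by (subst emeasure_density) (auto intro!: sets_PiM_I_finite)
    also have "\<dots> = (\<integral>\<^sup>+x. (\<Prod>i\<in>I. f i (x i) * indicator (A i) (x i)) \<partial>PiM I M)"
    proof (rule nn_integral_cong)
      fix x assume "x \<in> space (PiM I M)"
      then have "x \<in> PiE I A \<longleftrightarrow> (\<forall>i\<in>I. x i \<in> A i)"
        by (auto simp: space_PiM PiE_def)
      then have "indicator (PiE I A) x = (\<Prod>i\<in>I. indicator (A i) (x i) :: ennreal)"
        using I by (auto simp: indicator_def prod_zero_iff)
      then show "(\<Prod>i\<in>I. f i (x i)) * indicator (PiE I A) x
          = (\<Prod>i\<in>I. f i (x i) * indicator (A i) (x i))"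
        by (simp add: prod.distrib)
    qed
    also have "\<dots> = (\<Prod>i\<in>I. \<integral>\<^sup>+x. f i x * indicator (A i) x \<partial>M i)"
      by (rule M.product_nn_integral_prod[OF I]) measurable
    also have "\<dots> = (\<Prod>i\<in>I. emeasure (density (M i) (f i)) (A i))"
      by (intro prod.cong refl) (simp add: emeasure_density)
    finally show "emeasure (density (PiM I M) (\<lambda>x. \<Prod>i\<in>I. f i (x i))) (PiE I A)
        = (\<Prod>i\<in>I. emeasure (density (M i) (f i)) (A i))" .
  qed
qed

text \<open>The sets where p is at most 1/(k + 1) decrease to the empty set because p is positive,
  so in a finite measure one of them has mass below \<open>\<epsilon>\<close>/2. A set of mass
  \<open>\<epsilon>\<close> keeps at least \<open>\<epsilon>\<close>/2 outside it, and there p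
  exceeds 1/(k + 1). This gives one \<open>\<delta>\<close> for all sets and stands in for a lower
  bound on p.\<close>

lemma density_mass_lower_bound:
  fixes p :: "'a \<Rightarrow> real"
  assumes "finite_measure M" and p [measurable]: "p \<in> borel_measurable M"
    and pos: "\<And>x. x \<in> space M \<Longrightarrow> 0 < p x" and "0 < \<epsilon>"
  obtains \<delta> where "0 < \<delta>"
    "\<And>A. A \<in> sets M \<Longrightarrow> ennreal \<epsilon> \<le> emeasure M A \<Longrightarrow> ennreal \<delta> \<le> emeasure (density M p) A"
proof -
  interpret finite_measure M by fact
  define N where "N = (\<lambda>k::nat. {x \<in> space M. p x \<le> 1 / Suc k})"
  have N [measurable]: "N k \<in> sets M" for k
    unfolding N_def by measurable
  have "decseq N"
  proof (rule decseq_SucI)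
    have "1 / real (Suc (Suc n)) \<le> 1 / real (Suc n)" for n
      by (rule divide_left_mono) auto
    then show "N (Suc n) \<subseteq> N n" for n
      unfolding N_def by (blast intro: order_trans)
  qed
  moreover have "(\<Inter>k. N k) = {}"
  proof -
    have False if "\<And>k. x \<in> N k" for x
    proof -
      have "x \<in> space M" "0 < p x" using that[of 0] pos by (auto simp: N_def)
      then obtain k where "inverse (real (Suc k)) < p x"
        using reals_Archimedean by blast
      with that[of k] show False by (simp add: N_def inverse_eq_divide)
    qed
    then show ?thesis by blast
  qed
  ultimately have "(\<lambda>k. measure M (N k)) \<longlonglongrightarrow> 0"
    using finite_Lim_measure_decseq[of N] N by (auto simp: image_subset_iff)
  then have "eventually (\<lambda>k. measure M (N k) < \<epsilon> / 2) sequentially"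
    using \<open>0 < \<epsilon>\<close> by (intro order_tendstoD) auto
  then obtain k where k: "measure M (N k) < \<epsilon> / 2"
    by (auto simp: eventually_sequentially)
  show ?thesis
  proof (rule that[of "\<epsilon> / 2 / Suc k"])
    fix A assume A [measurable]: "A \<in> sets M" and "ennreal \<epsilon> \<le> emeasure M A"
    then have "\<epsilon> \<le> measure M A"
      by (simp add: emeasure_eq_measure)
    also have "measure M A \<le> measure M (A - N k) + measure M (N k)"
      using finite_measure_mono[of A "(A - N k) \<union> N k"]
        finite_measure_Union[of "A - N k" "N k"] by (simp add: Diff_Int_distrib2)
    finally have *: "\<epsilon> / 2 \<le> measure M (A - N k)"
      using k by linarith
    have "ennreal (\<epsilon> / 2 / Suc k) \<le> ennreal (1 / Suc k) * emeasure M (A - N k)"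
      using divide_right_mono[OF *, of "real (Suc k)"]
      by (simp add: emeasure_eq_measure ennreal_mult[symmetric] ennreal_leI)
    also have "\<dots> = (\<integral>\<^sup>+x. ennreal (1 / Suc k) * indicator (A - N k) x \<partial>M)"
      by (rule nn_integral_cmult_indicator[symmetric]) measurable
    also have "\<dots> \<le> (\<integral>\<^sup>+x. ennreal (p x) * indicator A x \<partial>M)"
      by (intro nn_integral_mono)
        (auto simp: N_def indicator_def not_le intro!: ennreal_leI intro: less_imp_le)
    also have "\<dots> = emeasure (density M p) A"
      by (simp add: emeasure_density)
    finally show "ennreal (\<epsilon> / 2 / Suc k) \<le> emeasure (density M p) A" .
  qed (use \<open>0 < \<epsilon>\<close> in simp)
qed

section \<open>Bi-Lipschitz maps of the square\<close>

lemma I2_iff: "x \<in> I2 \<longleftrightarrow> \<bar>x $ 1\<bar> \<le> 1 \<and> \<bar>x $ 2\<bar> \<le> 1"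
  by (auto simp: I2_def forall_2)

lemma I2_eq_cbox: "I2 = cbox (-1) 1"
  by (auto simp: I2_def mem_box_cart)

lemma I2_sets [measurable]: "I2 \<in> sets borel"
  unfolding I2_eq_cbox by (intro borel_closed closed_cbox)

lemma emeasure_I2_finite: "emeasure lborel I2 < \<infinity>"
  unfolding I2_eq_cbox by (rule emeasure_lborel_cbox_finite)

text \<open>A perturbation of the identity with Lipschitz constant 1/2 changes distances by at most
  a half, which gives the bi-Lipschitz constant 2 and injectivity. Since the shift is horizontal,
  surjectivity is a one-dimensional question on each row.\<close>

lemma horizontal_shift_in_F_INV:
  fixes g :: "real^2 \<Rightarrow> real"
  assumes lip: "\<And>x y. \<bar>g x - g y\<bar> \<le> norm (x - y) / 2"
    and bdry: "\<And>x. \<lbrakk>x \<in> I2; \<bar>x $ 1\<bar> = 1\<rbrakk> \<Longrightarrow> g x = 0"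
  shows "(\<lambda>x. x + g x *\<^sub>R axis 1 1) \<in> F_INV"
proof -
  define f where "f = (\<lambda>x::real^2. x + g x *\<^sub>R axis 1 1)"
  have f1: "f x $ 1 = x $ 1 + g x" and f2: "f x $ 2 = x $ 2" for x
    by (auto simp: f_def axis_def)
  have diff: "f x - f y = (x - y) + (g x - g y) *\<^sub>R axis 1 1" for x y
    by (simp add: f_def algebra_simps)
  have nrm: "norm ((g x - g y) *\<^sub>R (axis 1 1 :: real^2)) \<le> norm (x - y) / 2" for x y
    using lip[of x y] by simp
  have upper: "norm (f x - f y) \<le> 2 * norm (x - y)" for x y
    using norm_triangle_ineq[of "x - y" "(g x - g y) *\<^sub>R (axis 1 1 :: real^2)"] nrm[of x y]
      norm_ge_zero[of "x - y"]
    unfolding diff by linarith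
  have lower: "inverse 2 * norm (x - y) \<le> norm (f x - f y)" for x y
    using norm_diff_ineq[of "x - y" "(g x - g y) *\<^sub>R (axis 1 1 :: real^2)"] nrm[of x y]
    unfolding diff by simp
  \<comment> \<open>Comparison with the point of the same row on the edge with first coordinate
    \<open>s\<close>, where \<open>g\<close> vanishes: the shift is at most half the distance to
    either vertical edge, so no point leaves the square.\<close>
  have proj: "\<bar>g x\<bar> \<le> \<bar>x $ 1 - s\<bar> / 2" if "x \<in> I2" "\<bar>s\<bar> = 1" for x s
  proof -
    define y where "y = (\<chi> j. if j = 1 then s else x $ j)"
    have gy: "g y = 0"
      using that by (intro bdry) (auto simp: I2_iff y_def)
    have "x - y = (x $ 1 - s) *\<^sub>R axis 1 1"
      by (auto simp: vec_eq_iff y_def axis_def)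
    then have nrm: "norm (x - y) = \<bar>x $ 1 - s\<bar>"
      by (simp only: norm_scaleR norm_axis_1 mult_1_right real_norm_def)
    show ?thesis
      using lip[of x y] unfolding gy nrm by simp
  qed
  have maps: "f x \<in> I2" if "x \<in> I2" for x
    using proj[OF that, of 1] proj[OF that, of "-1"] that
    unfolding I2_iff f1 f2 by auto
  have "inj_on f I2"
  proof (rule inj_onI)
    fix x y assume "f x = f y"
    then show "x = y" using lower[of x y] by simp
  qed
  moreover have "y \<in> f ` I2" if y: "y \<in> I2" for y
  proof -
    \<comment> \<open>\<open>l\<close> parametrises the row of \<open>y\<close>. Along it the first
      coordinate of the image is continuous and runs from -1 to 1, so the intermediate value theorem
      finds a preimage.\<close>
    define l where "l = (\<lambda>t. \<chi> j. if j = (1::2) then t else y $ j)"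
    have l1: "l t $ 1 = t" and l2: "l t $ 2 = y $ 2" for t
      by (auto simp: l_def)
    have "continuous_on UNIV g"
    proof (rule lipschitz_on_continuous_on)
      show "(1/2)-lipschitz_on UNIV g"
        using lip by (intro lipschitz_onI) (auto simp: dist_norm)
    qed
    moreover have "continuous_on {-1..1} l"
      unfolding l_def
    proof (rule continuous_on_vec_lambda)
      show "continuous_on {-1..1} (\<lambda>t. if j = 1 then t else y $ j)" for j :: 2
        by (cases "j = 1") (auto intro!: continuous_intros)
    qed
    ultimately have "continuous_on {-1..1} (\<lambda>t. t + g (l t))"
      by (auto intro!: continuous_intros intro: continuous_on_compose2)
    moreover have "g (l s) = 0" if "\<bar>s\<bar> = 1" for s
      using that y by (intro bdry) (auto simp: I2_iff l1 l2)
    ultimately obtain t where t: "-1 \<le> t" "t \<le> 1" "t + g (l t) = y $ 1"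
      using IVT'[of "\<lambda>t. t + g (l t)" "-1" "y $ 1" 1] y by (fastforce simp: I2_iff)
    have "f (l t) = y"
      using t by (simp add: vec_eq_iff forall_2 f1 f2 l1 l2)
    moreover have "l t \<in> I2"
      using t y by (auto simp: I2_iff l1 l2)
    ultimately show ?thesis by blast
  qed
  ultimately have "bij_betw f I2 I2"
    using maps by (auto simp: bij_betw_def)
  then show ?thesis
    unfolding F_INV_def f_def[symmetric] using upper lower
    by (auto intro!: exI[of _ "2::real"])
qed

section \<open>Pyramid bumps on a grid of squares\<close>

definition bump_centre :: "nat \<Rightarrow> nat \<Rightarrow> real" where
  "bump_centre m i = (2 * real i + 1) / real m - 1"

text \<open>\<open>bump_centre m i\<close> is the midpoint of the i-th of m cells of width 2/m in
  [-1,1], counted from 0. The bump is half the sup-distance to the boundary of the square cell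
  \<open>k\<close>, cut off at 0 outside; the factor 1/2 provides the Lipschitz constant that
  \<open>horizontal_shift_in_F_INV\<close> asks for.\<close>

definition bump :: "nat \<Rightarrow> nat \<times> nat \<Rightarrow> real^2 \<Rightarrow> real" where
  "bump m k x =
     max 0 (1 / m - max \<bar>x $ 1 - bump_centre m (fst k)\<bar> \<bar>x $ 2 - bump_centre m (snd k)\<bar>) / 2"

definition bumps :: "nat \<Rightarrow> (nat \<times> nat) set \<Rightarrow> real^2 \<Rightarrow> real" where
  "bumps m S x = (\<Sum>k\<in>S. bump m k x)"

lemma bump_nonneg: "0 \<le> bump m k x"
  by (simp add: bump_def)

lemma bump_le: "bump m k x \<le> 1 / (2 * real m)"
  by (auto simp: bump_def field_simps max_def)

lemma bump_pos_iff:
  "0 < bump m k x \<longleftrightarrow>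
     \<bar>x $ 1 - bump_centre m (fst k)\<bar> < 1 / m \<and> \<bar>x $ 2 - bump_centre m (snd k)\<bar> < 1 / m"
  by (auto simp: bump_def max_def)

lemma bump_lipschitz: "bump m k x - bump m k y \<le> norm (x - y) / 2"
  using component_le_norm_cart[of "x - y" 1] component_le_norm_cart[of "x - y" 2]
  by (auto simp: bump_def max_def abs_if split: if_splits)

lemma continuous_on_bump: "continuous_on A (bump m k)"
  unfolding bump_def by (intro continuous_intros) auto

lemma continuous_on_bumps: "continuous_on A (bumps m S)"
  unfolding bumps_def[abs_def] by (intro continuous_intros continuous_on_bump)

text \<open>Centres differ by integer multiples of 2/m, while the two strict bounds place them less
  than 2/m apart.\<close>

lemma bump_centre_separated:
  assumes "\<bar>t - bump_centre m i\<bar> < 1 / m" "\<bar>t - bump_centre m j\<bar> < 1 / m"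
  shows "i = j"
proof -
  have m: "0 < real m"
    using assms(1) by (cases "m = 0") auto
  have "\<bar>bump_centre m i - bump_centre m j\<bar> < 2 / m"
    using assms by linarith
  also have "bump_centre m i - bump_centre m j = (real i - real j) * (2 / m)"
    using m by (simp add: bump_centre_def field_simps)
  finally have "\<bar>real i - real j\<bar> < 1"
    using m by (simp add: abs_mult field_simps)
  then show ?thesis by linarith
qed

lemma bump_disjoint:
  assumes "0 < bump m k x" "0 < bump m l x"
  shows "k = l"
  using assms bump_centre_separated unfolding bump_pos_iff by (metis prod.expand)

lemma bumps_insert: "\<lbrakk>finite S; k \<notin> S\<rbrakk> \<Longrightarrow> bumps m (insert k S) x = bumps m S x + bump m k x"
  by (simp add: bumps_def)

lemma bumps_eq_bump:
  assumes "finite S" "k \<in> S" "0 < bump m k x"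
  shows "bumps m S x = bump m k x"
proof -
  have "bump m l x = 0" if "l \<in> S - {k}" for l
    using that bump_disjoint[OF assms(3), of l] bump_nonneg[of m l x] by (cases "0 < bump m l x") auto
  then show ?thesis
    using assms by (simp add: bumps_def sum.remove)
qed

text \<open>Supports are disjoint, so at each point at most one bump is active. This reduces
  statements about the sum to statements about a single bump.\<close>

lemma bumps_cases:
  assumes "finite S"
  obtains "bumps m S x = 0" | k where "k \<in> S" "0 < bump m k x" "bumps m S x = bump m k x"
proof (cases "\<exists>k\<in>S. 0 < bump m k x")
  case True
  then show ?thesis using bumps_eq_bump[OF assms] that(2) by blast
next
  case False
  then have "bumps m S x = 0"
    using bump_nonneg[of m _ x] by (auto simp: bumps_def intro!: sum.neutral antisym simp: not_less)
  then show ?thesis by (rule that(1))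
qed

lemma bump_le_bumps: "\<lbrakk>finite S; k \<in> S\<rbrakk> \<Longrightarrow> bump m k x \<le> bumps m S x"
  unfolding bumps_def by (rule member_le_sum) (auto simp: bump_nonneg)

text \<open>Adding up Lipschitz constants would lose a factor growing with the number of squares.
  Instead, only one bump is active at x, and at y this bump is at most the whole sum, so the
  constant 1/2 of a single bump survives.\<close>

lemma bumps_lipschitz:
  assumes "finite S"
  shows "\<bar>bumps m S x - bumps m S y\<bar> \<le> norm (x - y) / 2"
proof -
  have *: "bumps m S x - bumps m S y \<le> norm (x - y) / 2" for x y
  proof (cases rule: bumps_cases[OF assms, of m x])
    case 1
    have "0 \<le> bumps m S y" by (simp add: bumps_def sum_nonneg bump_nonneg)
    with 1 show ?thesis by (auto intro: order_trans[of _ 0])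
  next
    case (2 k)
    then show ?thesis
      using bump_le_bumps[OF assms, of k m y] bump_lipschitz[of m k x y] by linarith
  qed
  show ?thesis
    using *[of x y] *[of y x] by (auto simp: norm_minus_commute abs_if)
qed

lemma bump_centre_bounds:
  assumes "i < m"
  shows "1 / m - 1 \<le> bump_centre m i" "bump_centre m i \<le> 1 - 1 / m"
proof -
  have "real i + 1 \<le> real m" using assms by linarith
  then have "(real i + 1) / m \<le> 1"
    using assms by (subst divide_le_eq_1_pos) auto
  then show "bump_centre m i \<le> 1 - 1 / m"
    by (simp add: bump_centre_def add_divide_distrib)
  show "1 / m - 1 \<le> bump_centre m i"
    by (simp add: bump_centre_def add_divide_distrib)
qed

lemma bumps_eq_0_boundary:
  assumes "S \<subseteq> {..<m} \<times> {..<m}" "\<bar>x $ 1\<bar> = 1"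
  shows "bumps m S x = 0"
proof -
  have "bump m k x = 0" if "k \<in> S" for k
  proof (rule ccontr)
    assume "bump m k x \<noteq> 0"
    then have "0 < bump m k x" using bump_nonneg[of m k x] by simp
    moreover have "fst k < m" using that assms(1) by auto
    ultimately show False
      using bump_centre_bounds[of "fst k" m] assms(2) unfolding bump_pos_iff by linarith
  qed
  then show ?thesis by (simp add: bumps_def)
qed

definition bump_map :: "nat \<Rightarrow> (nat \<times> nat) set \<Rightarrow> real^2 \<Rightarrow> real^2" where
  "bump_map m S x = x + bumps m S x *\<^sub>R axis 1 1"

lemma bump_map_in_F_INV:
  assumes "S \<subseteq> {..<m} \<times> {..<m}"
  shows "bump_map m S \<in> F_INV"
  unfolding bump_map_def[abs_def]
proof (rule horizontal_shift_in_F_INV)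
  have "finite S" using assms by (rule finite_subset) auto
  then show "\<bar>bumps m S x - bumps m S y\<bar> \<le> norm (x - y) / 2" for x y
    by (rule bumps_lipschitz)
qed (use bumps_eq_0_boundary[OF assms] in auto)

lemma measurable_bumps [measurable]: "bumps m S \<in> borel_measurable borel"
  by (intro borel_measurable_continuous_onI continuous_on_bumps)

lemma measurable_bump [measurable]: "bump m k \<in> borel_measurable borel"
  by (intro borel_measurable_continuous_onI continuous_on_bump)

lemma measurable_bump_map [measurable]: "bump_map m S \<in> borel_measurable borel"
  unfolding bump_map_def[abs_def] by measurable

section \<open>Area of the region where the bumps are large\<close>

definition square :: "real \<Rightarrow> real \<Rightarrow> real \<Rightarrow> (real^2) set" where
  "square a b s = {x. \<bar>x $ 1 - a\<bar> \<le> s \<and> \<bar>x $ 2 - b\<bar> \<le> s}"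

lemma square_eq_cbox: "square a b s = cbox (vector [a - s, b - s]) (vector [a + s, b + s])"
  by (auto simp: square_def mem_box_cart forall_2 abs_le_iff)

lemma square_sets [measurable]: "square a b s \<in> sets borel"
  by (simp add: square_eq_cbox)

lemma emeasure_square:
  assumes "0 \<le> s"
  shows "emeasure lborel (square a b s) = ennreal (4 * s\<^sup>2)"
proof -
  have "emeasure lborel (square a b s) = ennreal (measure lborel (square a b s))"
    unfolding square_eq_cbox by (rule emeasure_eq_ennreal_measure)
      (use emeasure_lborel_cbox_finite in \<open>auto simp: less_top[symmetric]\<close>)
  also have "measure lborel (square a b s) = 4 * s\<^sup>2"
    using assms unfolding square_eq_cbox
    by (subst content_cbox_cart) (auto simp: interval_ne_empty_cart forall_2 UNIV_2 power2_eq_square)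
  finally show ?thesis .
qed

text \<open>On the concentric square of half the side length each bump is at least half its height
  1/(2m). These m^2 squares have area 1/m^2 each and are disjoint, because the bumps are positive on
  them.\<close>

lemma emeasure_bumps_large:
  assumes "m \<ge> 1"
  shows "1 \<le> emeasure lborel {x \<in> I2. 1 / (4 * real m) \<le> bumps m ({..<m} \<times> {..<m}) x}"
proof -
  let ?K = "{..<m} \<times> {..<m}"
  let ?Q = "\<lambda>k. square (bump_centre m (fst k)) (bump_centre m (snd k)) (1 / (2 * real m))"
  have m: "real m > 0" using assms by simp
  have large: "1 / (4 * real m) \<le> bump m k x" if "x \<in> ?Q k" for k x
  proof -
    have "max \<bar>x $ 1 - bump_centre m (fst k)\<bar> \<bar>x $ 2 - bump_centre m (snd k)\<bar> \<le> 1 / m / 2"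
      using that by (auto simp: square_def)
    then have "1 / m / 2 \<le> max 0 (1 / m - max \<bar>x $ 1 - bump_centre m (fst k)\<bar> \<bar>x $ 2 - bump_centre m (snd k)\<bar>)"
      by (intro max.coboundedI2) linarith
    then have "1 / m / 2 / 2 \<le> bump m k x"
      unfolding bump_def by (rule divide_right_mono) simp
    then show ?thesis by simp
  qed
  have pos: "0 < bump m k x" if "x \<in> ?Q k" for k x
  proof -
    have "0 < 1 / (4 * real m)" using m by simp
    also note large[OF that]
    finally show ?thesis .
  qed
  have "real m * real m * (4 * (1 / (2 * real m))\<^sup>2) = 1"
    using m by (simp add: power2_eq_square)
  then have "(\<Sum>k\<in>?K. 4 * (1 / (2 * real m))\<^sup>2) = 1"
    by (simp only: sum_constant card_cartesian_product card_lessThan of_nat_mult)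
  then have "1 = (\<Sum>k\<in>?K. ennreal (4 * (1 / (2 * real m))\<^sup>2))"
    by (subst sum_ennreal) (simp_all only: ennreal_1, simp)
  also have "\<dots> = (\<Sum>k\<in>?K. emeasure lborel (?Q k))"
    using m by (simp add: emeasure_square)
  also have "\<dots> = emeasure lborel (\<Union>k\<in>?K. ?Q k)"
  proof (rule sum_emeasure)
    show "disjoint_family_on ?Q ?K"
      using pos bump_disjoint unfolding disjoint_family_on_def by blast
  qed (auto simp: square_eq_cbox)
  also have "\<dots> \<le> emeasure lborel {x \<in> I2. 1 / (4 * real m) \<le> bumps m ?K x}"
  proof (rule emeasure_mono)
    show "(\<Union>k\<in>?K. ?Q k) \<subseteq> {x \<in> I2. 1 / (4 * real m) \<le> bumps m ?K x}"
    proof (rule subsetI)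
      fix x assume "x \<in> (\<Union>k\<in>?K. ?Q k)"
      then obtain i j where k: "i \<in> {..<m}" "j \<in> {..<m}" and x: "x \<in> ?Q (i, j)"
        by blast
      have "1 / (4 * real m) \<le> bumps m ?K x"
        using large[OF x] bump_le_bumps[of ?K "(i, j)" m x] k by auto
      moreover have "x \<in> I2"
        using pos[OF x] bump_centre_bounds[of i m] bump_centre_bounds[of j m] k
        unfolding bump_pos_iff I2_iff by auto
      ultimately show "x \<in> {x \<in> I2. 1 / (4 * real m) \<le> bumps m ?K x}" by simp
    qed
  qed measurable
  finally show ?thesis .
qed

section \<open>Two-point testing bound\<close>

text \<open>
  Minimising the first two terms on the right over \<open>u\<close> leaves \<open>d\<^sup>2 * (p * q / (p + q))\<close>. The
  inequality bounds this from below, with a free parameter \<open>t\<close>, by an expression whose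
  integral is known once that of \<open>q\<^sup>2 / p\<close> is.
\<close>
lemma two_point_inequality:
  fixes p q u d t :: real
  assumes "0 < p" "0 < q"
  shows "2 * t * d\<^sup>2 * q \<le> u\<^sup>2 * p + (u - d)\<^sup>2 * q + d\<^sup>2 * t\<^sup>2 * (q + q\<^sup>2 / p)"
proof -
  \<comment> \<open>The first term on the right comes from completing the square in
    \<open>u\<close>, the second from completing it in \<open>t\<close>.\<close>
  have "u\<^sup>2 * p + (u - d)\<^sup>2 * q + d\<^sup>2 * t\<^sup>2 * (q + q\<^sup>2 / p) - 2 * t * d\<^sup>2 * q
      = ((p + q) * u - q * d)\<^sup>2 / (p + q) + d\<^sup>2 * q * (p - t * (p + q))\<^sup>2 / (p * (p + q))"
  proof -
    define s where "s = p + q"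
    have s: "s > 0" "q = s - p" using assms by (auto simp: s_def)
    show ?thesis
      unfolding s_def[symmetric] unfolding s(2) using assms(1) s(1)
      by (simp add: field_simps power2_eq_square)
  qed
  also have "\<dots> \<ge> 0"
    using assms by (intro add_nonneg_nonneg divide_nonneg_nonneg mult_nonneg_nonneg) auto
  finally show ?thesis by simp
qed

text \<open>The pointwise inequality with u = T - a and d = b - a, integrated. \<open>S\<close>
  bounds the integral of q^2/p, which is the second moment of the likelihood ratio q/p under
  p.\<close>

lemma two_point_lower_bound:
  fixes p q T :: "'a \<Rightarrow> real" and a b S :: real
  assumes [measurable]: "p \<in> borel_measurable M" "q \<in> borel_measurable M" "T \<in> borel_measurable M"
    and pos: "\<And>x. x \<in> space M \<Longrightarrow> 0 < p x" "\<And>x. x \<in> space M \<Longrightarrow> 0 < q x"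
    and q1: "(\<integral>\<^sup>+x. q x \<partial>M) = 1"
    and S: "(\<integral>\<^sup>+x. (q x)\<^sup>2 / p x \<partial>M) \<le> ennreal S" "0 \<le> S"
  shows "ennreal ((b - a)\<^sup>2 / (1 + S))
    \<le> (\<integral>\<^sup>+x. (T x - a)\<^sup>2 \<partial>density M p) + (\<integral>\<^sup>+x. (T x - b)\<^sup>2 \<partial>density M q)"
proof -
  \<comment> \<open>This \<open>t\<close> maximises 2t - t^2 (1 + S), and the maximum is again 1/(1
    + S).\<close>
  define d t where "d = b - a" and "t = 1 / (1 + S)"
  let ?R = "(\<integral>\<^sup>+x. (T x - a)\<^sup>2 \<partial>density M p) + (\<integral>\<^sup>+x. (T x - b)\<^sup>2 \<partial>density M q)"
  have t: "0 \<le> t" using S(2) by (simp add: t_def)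
  have "ennreal (2 * t * d\<^sup>2) = (\<integral>\<^sup>+x. ennreal (2 * t * d\<^sup>2) * q x \<partial>M)"
    by (simp add: nn_integral_cmult q1)
  also have "\<dots> \<le> (\<integral>\<^sup>+x. ennreal (p x) * ennreal ((T x - a)\<^sup>2)
      + ennreal (q x) * ennreal ((T x - b)\<^sup>2)
      + ennreal (d\<^sup>2 * t\<^sup>2) * (ennreal (q x) + ennreal ((q x)\<^sup>2 / p x)) \<partial>M)"
  proof (rule nn_integral_mono)
    fix x assume "x \<in> space M"
    note px = pos[OF this]
    show "ennreal (2 * t * d\<^sup>2) * ennreal (q x) \<le> ennreal (p x) * ennreal ((T x - a)\<^sup>2)
        + ennreal (q x) * ennreal ((T x - b)\<^sup>2) + ennreal (d\<^sup>2 * t\<^sup>2) * (ennreal (q x) + ennreal ((q x)\<^sup>2 / p x))"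
      using two_point_inequality[OF px, of t d "T x - a"] px t
      by (simp add: d_def ennreal_mult[symmetric] ennreal_plus[symmetric] mult.commute algebra_simps
           del: ennreal_plus)
  qed
  also have "\<dots> = ?R + ennreal (d\<^sup>2 * t\<^sup>2) * (1 + (\<integral>\<^sup>+x. (q x)\<^sup>2 / p x \<partial>M))"
    by (simp add: nn_integral_add nn_integral_cmult nn_integral_density q1)
  also have "\<dots> \<le> ?R + ennreal (d\<^sup>2 * t\<^sup>2) * ennreal (1 + S)"
    using S by (intro add_left_mono mult_left_mono) (auto simp: ennreal_plus)
  also have "ennreal (d\<^sup>2 * t\<^sup>2) * ennreal (1 + S) = ennreal (t * d\<^sup>2)"
  proof -
    have "t * (1 + S) = 1"
      using S(2) by (simp add: t_def)
    then have "d\<^sup>2 * t\<^sup>2 * (1 + S) = t * d\<^sup>2"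
      unfolding power2_eq_square by algebra
    then show ?thesis
      using S(2) by (simp only: ennreal_mult''[symmetric] zero_le_power2 zero_le_mult_iff)
  qed
  finally have "ennreal (t * d\<^sup>2) + ennreal (t * d\<^sup>2) \<le> ?R + ennreal (t * d\<^sup>2)"
    using t by (simp add: ennreal_plus[symmetric] mult.assoc del: ennreal_plus)
  \<comment> \<open>The common summand is finite, hence it cancels in \<open>ennreal\<close> even if
    \<open>?R\<close> is infinite.\<close>
  then have "ennreal (t * d\<^sup>2) \<le> ?R"
    unfolding add.commute[of ?R] ennreal_add_left_cancel_le by simp
  then show ?thesis
    by (simp add: d_def t_def)
qed

section \<open>Gaussian likelihoods\<close>

definition vec_normal_density :: "real \<Rightarrow> real^2 \<Rightarrow> real" where
  "vec_normal_density \<sigma> e = (\<Prod>j\<in>UNIV. normal_density 0 \<sigma> (e $ j))"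

lemma vec_normal_density_pos: "0 < \<sigma> \<Longrightarrow> 0 < vec_normal_density \<sigma> e"
  unfolding vec_normal_density_def by (intro prod_pos ballI normal_density_pos)

lemma measurable_vec_normal_density [measurable]: "vec_normal_density \<sigma> \<in> borel_measurable borel"
  unfolding vec_normal_density_def[abs_def] by measurable

lemma nn_integral_vec_normal_density:
  assumes "0 < \<sigma>"
  shows "(\<integral>\<^sup>+e. vec_normal_density \<sigma> e \<partial>lborel) = 1"
proof -
  have inj: "inj (\<lambda>j::2. axis j (1::real))"
    by (auto simp: inj_on_def axis_eq_axis)
  \<comment> \<open>Lebesgue measure on the plane factorises over \<open>Basis\<close>, so the
    product over coordinates is reindexed by the unit vectors.\<close>
  have Basis: "(Basis :: (real^2) set) = range (\<lambda>j. axis j 1)"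
    by (auto simp: Basis_vec_def)
  have "vec_normal_density \<sigma> e = (\<Prod>b\<in>Basis. normal_density 0 \<sigma> (e \<bullet> b))" for e
    unfolding vec_normal_density_def Basis
    by (subst prod.reindex[OF inj]) (simp add: inner_axis)
  then have "(\<integral>\<^sup>+e. vec_normal_density \<sigma> e \<partial>lborel)
      = (\<integral>\<^sup>+e. (\<Prod>b\<in>Basis. ennreal (normal_density 0 \<sigma> (e \<bullet> b))) \<partial>(lborel :: (real^2) measure))"
    using assms by (simp add: prod_ennreal)
  also have "\<dots> = (\<Prod>b\<in>(Basis :: (real^2) set). \<integral>\<^sup>+x. normal_density 0 \<sigma> x \<partial>lborel)"
    by (rule nn_integral_lborel_prod[of "\<lambda>_ x. ennreal (normal_density 0 \<sigma> x)"]) auto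
  also have "(\<integral>\<^sup>+x. normal_density 0 \<sigma> x \<partial>lborel) = 1"
    using prob_space.emeasure_space_1[OF prob_space_normal_density[OF assms, of 0]]
    by (simp add: emeasure_density)
  finally show ?thesis by simp
qed

lemma nn_integral_vec_normal_density_shift:
  assumes "0 < \<sigma>"
  shows "(\<integral>\<^sup>+y. vec_normal_density \<sigma> (y - v) \<partial>lborel) = 1"
proof -
  have "(\<integral>\<^sup>+y. vec_normal_density \<sigma> (y - v) \<partial>lborel)
      = (\<integral>\<^sup>+y. vec_normal_density \<sigma> (y - v) \<partial>distr lborel borel ((+) v))"
    by (simp add: lborel_distr_plus)
  also have "\<dots> = 1"
    using nn_integral_vec_normal_density[OF assms] by (simp add: nn_integral_distr)
  finally show ?thesis .
qed

text \<open>Completing the square: 2(y - w)^2 - (y - v)^2 = (y - (2w - v))^2 - 2(w - v)^2. The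
  quotient is thus a multiple of a Gaussian density centred at 2w - v, and its integral over y is
  explicit.\<close>

lemma normal_density_sq_div:
  assumes "0 < \<sigma>"
  shows "(normal_density 0 \<sigma> (y - w))\<^sup>2 / normal_density 0 \<sigma> (y - v)
    = exp ((w - v)\<^sup>2 / \<sigma>\<^sup>2) * normal_density 0 \<sigma> (y - (2 * w - v))"
proof -
  have e: "exp (- ((y - w)\<^sup>2 / (2 * \<sigma>\<^sup>2))) ^ 2 = exp ((w - v)\<^sup>2 / \<sigma>\<^sup>2) *
     exp (- ((y - (2 * w - v))\<^sup>2 / (2 * \<sigma>\<^sup>2))) * exp (- ((y - v)\<^sup>2 / (2 * \<sigma>\<^sup>2)))"
    using assms
    by (simp add: exp_add[symmetric] exp_double[symmetric] field_simps)
       (simp add: power2_eq_square algebra_simps)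
  show ?thesis
    using assms e
    by (simp add: normal_density_def divide_simps power2_eq_square)
qed

lemma vec_normal_density_sq_div:
  assumes "0 < \<sigma>"
  shows "(vec_normal_density \<sigma> (y - w))\<^sup>2 / vec_normal_density \<sigma> (y - v)
    = exp ((norm (w - v))\<^sup>2 / \<sigma>\<^sup>2) * vec_normal_density \<sigma> (y - (2 *\<^sub>R w - v))"
proof -
  have "(norm (w - v))\<^sup>2 = (\<Sum>j\<in>UNIV. (w $ j - v $ j)\<^sup>2)"
    unfolding power2_norm_eq_inner by (simp add: inner_vec_def power2_eq_square)
  then have "exp ((norm (w - v))\<^sup>2 / \<sigma>\<^sup>2) = (\<Prod>j\<in>UNIV. exp ((w $ j - v $ j)\<^sup>2 / \<sigma>\<^sup>2))"
    by (simp add: sum_divide_distrib exp_sum)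
  then show ?thesis
    using normal_density_sq_div[OF assms]
    by (simp add: vec_normal_density_def prod.distrib[symmetric] prod_power_distrib prod_dividef[symmetric])
qed

section \<open>The regression model and its likelihoods\<close>

locale regression_design = prob_space P for P :: "(real^2) measure" +
  fixes \<sigma> B :: real
  assumes sets_P [measurable_cong]: "sets P = sets (restrict_space borel I2)"
    and sigma_pos: "0 < \<sigma>"
    and B_nonneg: "0 \<le> B"
    and P_le: "\<And>A. A \<in> sets borel \<Longrightarrow> emeasure P (A \<inter> I2) \<le> ennreal B * emeasure lborel A"
begin

lemma space_P: "space P = I2"
  using sets_eq_imp_space_eq[OF sets_P] by (simp add: space_restrict_space)

lemma Int_I2_sets: "A \<in> sets borel \<Longrightarrow> A \<inter> I2 \<in> sets P"
  unfolding sets_P sets_restrict_space by (rule image_eqI[of _ _ A]) auto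

lemma sets_base: "sets (P \<Otimes>\<^sub>M lborel) = sets obs_space"
  unfolding obs_space_def by (intro sets_pair_measure_cong) (simp_all add: sets_P)

lemma prob_space_noise: "prob_space (noise_law \<sigma>)"
  using nn_integral_vec_normal_density[OF sigma_pos]
  by (intro prob_spaceI)
    (simp add: noise_law_def emeasure_density flip: vec_normal_density_def)

text \<open>Translation invariance of Lebesgue measure moves the shift \<open>v\<close> from the
  argument of \<open>h\<close> into the density.\<close>

lemma nn_integral_noise:
  assumes [measurable]: "h \<in> borel_measurable borel"
  shows "(\<integral>\<^sup>+e. h (v + e) \<partial>noise_law \<sigma>) = (\<integral>\<^sup>+y. ennreal (vec_normal_density \<sigma> (y - v)) * h y \<partial>lborel)"
proof -
  have "(\<integral>\<^sup>+y. ennreal (vec_normal_density \<sigma> (y - v)) * h y \<partial>lborel)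
      = (\<integral>\<^sup>+y. ennreal (vec_normal_density \<sigma> (y - v)) * h y \<partial>distr lborel borel ((+) v))"
    by (simp add: lborel_distr_plus)
  also have "\<dots> = (\<integral>\<^sup>+e. ennreal (vec_normal_density \<sigma> e) * h (v + e) \<partial>lborel)"
    by (simp add: nn_integral_distr)
  also have "\<dots> = (\<integral>\<^sup>+e. h (v + e) \<partial>noise_law \<sigma>)"
    unfolding noise_law_def vec_normal_density_def[symmetric] by (simp add: nn_integral_density)
  finally show ?thesis by simp
qed

context
  fixes f :: "real^2 \<Rightarrow> real^2"
  assumes f [measurable]: "f \<in> borel_measurable borel"
begin

lemma measurable_observation:
  "(\<lambda>(x, e). (x, f x + e)) \<in> (P \<Otimes>\<^sub>M noise_law \<sigma>) \<rightarrow>\<^sub>M obs_space"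
proof -
  have [measurable_cong]: "sets (noise_law \<sigma>) = sets borel" by (simp add: noise_law_def)
  have [measurable]: "f \<in> borel_measurable P"
    using measurable_restrict_space1[OF f] by (simp cong: measurable_cong_sets add: sets_P)
  have [measurable]: "(\<lambda>x. x) \<in> P \<rightarrow>\<^sub>M restrict_space borel I2"
    by (rule measurable_ident_sets) (rule sets_P)
  show ?thesis unfolding obs_space_def by measurable
qed

lemma measurable_on_design: "f \<in> borel_measurable P"
  using measurable_restrict_space1[OF f] by (simp cong: measurable_cong_sets add: sets_P)

lemma measurable_residual [measurable]:
  "(\<lambda>z. snd z - f (fst z)) \<in> borel_measurable (P \<Otimes>\<^sub>M lborel)"
proof -
  have [measurable]: "(\<lambda>z. f (fst z)) \<in> borel_measurable (P \<Otimes>\<^sub>M lborel)"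
    by (rule measurable_compose[OF measurable_fst measurable_on_design])
  show ?thesis by measurable
qed

text \<open>All regression functions get the same dominating measure, so their laws can be compared
  through densities. For fixed x it is the shift by f x from
  \<open>nn_integral_noise\<close>.\<close>

lemma obs_law_eq_density:
  "obs_law P \<sigma> f = density (P \<Otimes>\<^sub>M lborel) (\<lambda>z. ennreal (vec_normal_density \<sigma> (snd z - f (fst z))))"
proof (rule measure_eqI)
  show "sets (obs_law P \<sigma> f)
      = sets (density (P \<Otimes>\<^sub>M lborel) (\<lambda>z. ennreal (vec_normal_density \<sigma> (snd z - f (fst z)))))"
    unfolding obs_law_def sets_distr sets_density sets_base ..
next
  interpret noise: prob_space "noise_law \<sigma>" by (rule prob_space_noise)
  fix A assume "A \<in> sets (obs_law P \<sigma> f)"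
  then have A: "A \<in> sets obs_space" by (simp add: obs_law_def)
  then have A' [measurable]: "A \<in> sets (P \<Otimes>\<^sub>M lborel)" unfolding sets_base .
  have "emeasure (obs_law P \<sigma> f) A = (\<integral>\<^sup>+z. indicator A z \<partial>obs_law P \<sigma> f)"
    using A by (simp add: obs_law_def)
  also have "\<dots> = (\<integral>\<^sup>+z. indicator A ((\<lambda>(x, e). (x, f x + e)) z) \<partial>(P \<Otimes>\<^sub>M noise_law \<sigma>))"
    unfolding obs_law_def using A by (intro nn_integral_distr measurable_observation) auto
  also have "\<dots> = (\<integral>\<^sup>+x. \<integral>\<^sup>+e. indicator A (x, f x + e) \<partial>noise_law \<sigma> \<partial>P)"
    using A measurable_compose[OF measurable_observation, of "indicator A" borel]
    by (subst noise.nn_integral_fst[symmetric]) (auto simp: case_prod_beta')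
  also have "\<dots> = (\<integral>\<^sup>+x. \<integral>\<^sup>+y. ennreal (vec_normal_density \<sigma> (y - f x)) * indicator A (x, y) \<partial>lborel \<partial>P)"
  proof (rule nn_integral_cong)
    fix x assume "x \<in> space P"
    then have [measurable]: "(\<lambda>y. indicator A (x, y)) \<in> (borel_measurable borel :: (real^2 \<Rightarrow> ennreal) set)"
      using measurable_compose[OF measurable_Pair1'[of x P lborel], of "indicator A" borel] A' by simp
    show "(\<integral>\<^sup>+e. indicator A (x, f x + e) \<partial>noise_law \<sigma>)
        = (\<integral>\<^sup>+y. ennreal (vec_normal_density \<sigma> (y - f x)) * indicator A (x, y) \<partial>lborel)"
      by (rule nn_integral_noise) measurable
  qed
  also have "\<dots> = (\<integral>\<^sup>+z. ennreal (vec_normal_density \<sigma> (snd z - f (fst z))) * indicator A z \<partial>(P \<Otimes>\<^sub>M lborel))"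
    by (subst lborel.nn_integral_fst[symmetric]) auto
  also have "\<dots> = emeasure (density (P \<Otimes>\<^sub>M lborel)
      (\<lambda>z. ennreal (vec_normal_density \<sigma> (snd z - f (fst z))))) A"
    using measurable_compose[OF measurable_residual measurable_vec_normal_density] A'
    by (intro emeasure_density[symmetric]) auto
  finally show "emeasure (obs_law P \<sigma> f) A = emeasure (density (P \<Otimes>\<^sub>M lborel)
      (\<lambda>z. ennreal (vec_normal_density \<sigma> (snd z - f (fst z))))) A" .
qed

lemma prob_space_obs_law: "prob_space (obs_law P \<sigma> f)"
proof -
  interpret noise: prob_space "noise_law \<sigma>" by (rule prob_space_noise)
  interpret pair_prob_space P "noise_law \<sigma>" ..
  show ?thesis
    unfolding obs_law_def by (rule prob_space_distr) (rule measurable_observation)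
qed

lemma prob_space_data_law: "prob_space (data_law P \<sigma> n f)"
  unfolding data_law_def by (intro prob_space_PiM prob_space_obs_law)

end

definition base :: "nat \<Rightarrow> (nat \<Rightarrow> (real^2) \<times> (real^2)) measure" where
  "base n = PiM {..<n} (\<lambda>_. P \<Otimes>\<^sub>M lborel)"

definition likelihood :: "nat \<Rightarrow> (real^2 \<Rightarrow> real^2) \<Rightarrow> (nat \<Rightarrow> (real^2) \<times> (real^2)) \<Rightarrow> real" where
  "likelihood n f D = (\<Prod>i<n. vec_normal_density \<sigma> (snd (D i) - f (fst (D i))))"

lemma likelihood_pos: "0 < likelihood n f D"
  unfolding likelihood_def by (intro prod_pos ballI vec_normal_density_pos sigma_pos)

lemma sets_base_data [measurable_cong]: "sets (base n) = sets (data_space n)"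
  unfolding base_def data_space_def by (intro sets_PiM_cong refl sets_base)

lemma sigma_finite_obs_base: "sigma_finite_measure (P \<Otimes>\<^sub>M lborel)"
proof -
  interpret pair_sigma_finite P lborel ..
  show ?thesis ..
qed

lemma measurable_likelihood [measurable]:
  assumes f [measurable]: "f \<in> borel_measurable borel"
  shows "likelihood n f \<in> borel_measurable (base n)"
proof -
  note measurable_residual[OF f, measurable]
  show ?thesis unfolding likelihood_def[abs_def] base_def by measurable
qed

lemma data_law_eq_density:
  assumes f [measurable]: "f \<in> borel_measurable borel"
  shows "data_law P \<sigma> n f = density (base n) (\<lambda>D. ennreal (likelihood n f D))"
proof -
  note measurable_on_design[OF f, measurable]
  \<comment> \<open>Being a probability law, the density is sigma-finite, as
    \<open>PiM_density\<close> requires.\<close>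
  interpret obs: prob_space "obs_law P \<sigma> f" by (rule prob_space_obs_law) fact
  have "data_law P \<sigma> n f = density (base n)
      (\<lambda>D. \<Prod>i<n. ennreal (vec_normal_density \<sigma> (snd (D i) - f (fst (D i)))))"
    unfolding data_law_def base_def obs_law_eq_density[OF f]
    using obs.sigma_finite_measure_axioms sigma_finite_obs_base
    by (intro PiM_density) (auto simp: obs_law_eq_density[OF f])
  then show ?thesis
    using sigma_pos by (simp add: likelihood_def prod_ennreal vec_normal_density_pos less_imp_le)
qed

lemma sets_data_law [measurable_cong]: "sets (data_law P \<sigma> n f) = sets (data_space n)"
  unfolding data_law_def data_space_def obs_law_def by (intro sets_PiM_cong refl sets_distr)

lemma nn_integral_likelihood:
  assumes f [measurable]: "f \<in> borel_measurable borel"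
  shows "(\<integral>\<^sup>+D. likelihood n f D \<partial>base n) = 1"
  using prob_space.emeasure_space_1[OF prob_space_data_law[OF f, of n]]
  by (simp add: data_law_eq_density emeasure_density)

text \<open>The integrand is a product over the observations, so the integral is an n-th power. In
  each factor \<open>vec_normal_density_sq_div\<close> leaves a shifted Gaussian in y that
  integrates to 1, and only the exponential of the squared distance remains.\<close>

lemma nn_integral_likelihood_sq_div:
  assumes f: "f \<in> borel_measurable borel" and g: "g \<in> borel_measurable borel"
  shows "(\<integral>\<^sup>+D. (likelihood n g D)\<^sup>2 / likelihood n f D \<partial>base n)
    = (\<integral>\<^sup>+x. exp ((norm (g x - f x))\<^sup>2 / \<sigma>\<^sup>2) \<partial>P) ^ n"
proof -
  note measurable_on_design[OF f, measurable] measurable_on_design[OF g, measurable]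
  have [measurable]: "(\<lambda>z. f (fst z)) \<in> borel_measurable (P \<Otimes>\<^sub>M lborel)"
    and [measurable]: "(\<lambda>z. g (fst z)) \<in> borel_measurable (P \<Otimes>\<^sub>M lborel)"
    by (rule measurable_compose[OF measurable_fst measurable_on_design], rule f g)+
  interpret product_sigma_finite "\<lambda>_::nat. P \<Otimes>\<^sub>M lborel"
    by (rule product_sigma_finite.intro) (rule sigma_finite_obs_base)
  define h where "h z = exp ((norm (g (fst z) - f (fst z)))\<^sup>2 / \<sigma>\<^sup>2)
    * vec_normal_density \<sigma> (snd z - (2 *\<^sub>R g (fst z) - f (fst z)))" for z
  have h [measurable]: "h \<in> borel_measurable (P \<Otimes>\<^sub>M lborel)"
    unfolding h_def[abs_def] by measurable
  have h0: "0 \<le> h z" for z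
    unfolding h_def using vec_normal_density_pos[OF sigma_pos] by (simp add: less_imp_le)
  have "(likelihood n g D)\<^sup>2 / likelihood n f D = (\<Prod>i<n. h (D i))" for D
    unfolding likelihood_def h_def
    by (simp only: prod_power_distrib prod_dividef[symmetric] vec_normal_density_sq_div[OF sigma_pos])
  then have "(\<integral>\<^sup>+D. (likelihood n g D)\<^sup>2 / likelihood n f D \<partial>base n)
      = (\<integral>\<^sup>+D. (\<Prod>i<n. ennreal (h (D i))) \<partial>base n)"
    using h0 by (simp add: prod_ennreal)
  also have "\<dots> = (\<integral>\<^sup>+z. h z \<partial>(P \<Otimes>\<^sub>M lborel)) ^ n"
    unfolding base_def by (subst product_nn_integral_prod) auto
  also have "(\<integral>\<^sup>+z. h z \<partial>(P \<Otimes>\<^sub>M lborel)) = (\<integral>\<^sup>+x. \<integral>\<^sup>+y. h (x, y) \<partial>lborel \<partial>P)"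
    by (rule lborel.nn_integral_fst[symmetric]) measurable
  also have "\<dots> = (\<integral>\<^sup>+x. exp ((norm (g x - f x))\<^sup>2 / \<sigma>\<^sup>2) \<partial>P)"
    by (intro nn_integral_cong)
      (simp add: h_def ennreal_mult' nn_integral_cmult nn_integral_vec_normal_density_shift[OF sigma_pos])
  finally show ?thesis .
qed

lemma two_point_data_law:
  fixes T :: "(nat \<Rightarrow> (real^2) \<times> (real^2)) \<Rightarrow> real"
  assumes f [measurable]: "f \<in> borel_measurable borel" and g [measurable]: "g \<in> borel_measurable borel"
    and T [measurable]: "T \<in> borel_measurable (data_space n)"
    and V: "(\<integral>\<^sup>+x. exp ((norm (g x - f x))\<^sup>2 / \<sigma>\<^sup>2) \<partial>P) ^ n \<le> ennreal V" "0 \<le> V"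
  shows "ennreal ((b - a)\<^sup>2 / (1 + V))
    \<le> (\<integral>\<^sup>+D. (T D - a)\<^sup>2 \<partial>data_law P \<sigma> n f) + (\<integral>\<^sup>+D. (T D - b)\<^sup>2 \<partial>data_law P \<sigma> n g)"
  unfolding data_law_eq_density[OF f] data_law_eq_density[OF g]
proof (rule two_point_lower_bound)
  show "T \<in> borel_measurable (base n)"
    using T by (simp cong: measurable_cong_sets add: sets_base_data)
qed (use V in \<open>simp_all add: f g nn_integral_likelihood nn_integral_likelihood_sq_div likelihood_pos measurable_likelihood\<close>)

section \<open>Likelihood-ratio moments of a single bump and the pointwise bound\<close>

lemma nn_integral_bump_sq:
  assumes "m \<ge> 1"
  shows "(\<integral>\<^sup>+x. (bump m k x)\<^sup>2 \<partial>P) \<le> ennreal (B / real m ^ 4)"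
proof -
  have m: "0 < real m" using assms by simp
  let ?Q = "square (bump_centre m (fst k)) (bump_centre m (snd k)) (1 / real m)"
  have Q [measurable]: "?Q \<inter> I2 \<in> sets P"
    by (intro Int_I2_sets square_sets)
  \<comment> \<open>The squared height 1/(4m^2) is multiplied by the mass of the cell, which is at
    most \<open>B\<close> times its area 4/m^2.\<close>
  have "(\<integral>\<^sup>+x. (bump m k x)\<^sup>2 \<partial>P) \<le> (\<integral>\<^sup>+x. ennreal ((1 / (2 * real m))\<^sup>2) * indicator (?Q \<inter> I2) x \<partial>P)"
  proof (rule nn_integral_mono)
    fix x assume "x \<in> space P"
    then have x: "x \<in> I2" by (simp add: space_P)
    show "ennreal ((bump m k x)\<^sup>2) \<le> ennreal ((1 / (2 * real m))\<^sup>2) * indicator (?Q \<inter> I2) x"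
    proof (cases "0 < bump m k x")
      case True
      then have "x \<in> ?Q" unfolding bump_pos_iff square_def by auto
      moreover have "(bump m k x)\<^sup>2 \<le> (1 / (2 * real m))\<^sup>2"
        by (intro power_mono bump_le bump_nonneg)
      ultimately show ?thesis using x by (simp add: ennreal_leI)
    next
      case False
      then show ?thesis using bump_nonneg[of m k x] by simp
    qed
  qed
  also have "\<dots> = ennreal ((1 / (2 * real m))\<^sup>2) * emeasure P (?Q \<inter> I2)"
    by (rule nn_integral_cmult_indicator) measurable
  also have "\<dots> \<le> ennreal ((1 / (2 * real m))\<^sup>2) * (ennreal B * ennreal (4 * (1 / real m)\<^sup>2))"
    using P_le[of ?Q] by (intro mult_left_mono) (auto simp: emeasure_square)
  also have "\<dots> = ennreal ((1 / (2 * real m))\<^sup>2 * (B * (4 * (1 / real m)\<^sup>2)))"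
    using B_nonneg by (simp only: ennreal_mult''[symmetric] ennreal_mult'[symmetric] zero_le_power2)
  also have "(1 / (2 * real m))\<^sup>2 * (B * (4 * (1 / real m)\<^sup>2)) = B / real m ^ 4"
    using m by (simp add: power2_eq_square power4_eq_xxxx)
  finally show ?thesis .
qed

definition lr_moment_bound :: real where
  "lr_moment_bound = exp (exp (1 / (4 * \<sigma>\<^sup>2)) / \<sigma>\<^sup>2 * B)"

lemma lr_moment_bound_nonneg: "0 \<le> lr_moment_bound"
  by (simp add: lr_moment_bound_def)

text \<open>The integral exceeds 1 by at most \<open>\<kappa>\<close> B / m^4. Its n-th power is at
  most exp(n \<open>\<kappa>\<close> B / m^4), and n at most m^4 turns this into a constant that
  depends on \<open>\<sigma>\<close> and \<open>B\<close> alone.\<close>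

lemma exp_bump_bound:
  assumes m: "m \<ge> 1" and n: "real n \<le> real m ^ 4"
  shows "(\<integral>\<^sup>+x. exp ((bump m k x)\<^sup>2 / \<sigma>\<^sup>2) \<partial>P) ^ n \<le> ennreal lr_moment_bound"
proof -
  define \<kappa> where "\<kappa> = exp (1 / (4 * \<sigma>\<^sup>2)) / \<sigma>\<^sup>2"
  have \<kappa>: "0 \<le> \<kappa>" by (simp add: \<kappa>_def)
  have meas [measurable]: "bump m k \<in> borel_measurable P"
    using measurable_restrict_space1[OF measurable_bump] by (simp cong: measurable_cong_sets add: sets_P)
  have pw: "exp ((bump m k x)\<^sup>2 / \<sigma>\<^sup>2) \<le> 1 + \<kappa> * (bump m k x)\<^sup>2" for x
  proof -
    let ?z = "(bump m k x)\<^sup>2 / \<sigma>\<^sup>2"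
    have "1 / (2 * real m) \<le> 1 / 2" using m by (simp add: field_simps)
    then have "(bump m k x)\<^sup>2 \<le> (1 / 2)\<^sup>2"
      using bump_le[of m k x] by (intro power_mono bump_nonneg) auto
    then have z: "?z \<le> 1 / (4 * \<sigma>\<^sup>2)"
      using sigma_pos by (simp add: power2_eq_square field_simps)
    \<comment> \<open>From 1 - z at most exp(-z) follows exp z at most 1 + z exp z, which becomes
      linear in z once the last exponential is bounded by its value at 1/(4
      \<open>\<sigma>\<close>^2).\<close>
    have "(1 - ?z) * exp ?z \<le> exp (- ?z) * exp ?z"
      using exp_ge_add_one_self[of "- ?z"] by (intro mult_right_mono) auto
    then have "exp ?z \<le> 1 + ?z * exp ?z"
      by (simp add: exp_minus algebra_simps)
    also have "\<dots> \<le> 1 + ?z * exp (1 / (4 * \<sigma>\<^sup>2))"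
      using z by (intro add_left_mono mult_left_mono) auto
    also have "\<dots> = 1 + \<kappa> * (bump m k x)\<^sup>2"
      by (simp add: \<kappa>_def)
    finally show ?thesis .
  qed
  have "(\<integral>\<^sup>+x. exp ((bump m k x)\<^sup>2 / \<sigma>\<^sup>2) \<partial>P) \<le> (\<integral>\<^sup>+x. 1 + ennreal \<kappa> * ennreal ((bump m k x)\<^sup>2) \<partial>P)"
  proof (rule nn_integral_mono)
    fix x
    have "ennreal (exp ((bump m k x)\<^sup>2 / \<sigma>\<^sup>2)) \<le> ennreal (1 + \<kappa> * (bump m k x)\<^sup>2)"
      by (rule ennreal_leI) (rule pw)
    then show "ennreal (exp ((bump m k x)\<^sup>2 / \<sigma>\<^sup>2)) \<le> 1 + ennreal \<kappa> * ennreal ((bump m k x)\<^sup>2)"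
      using \<kappa> by (simp add: ennreal_plus ennreal_mult)
  qed
  also have "\<dots> = 1 + ennreal \<kappa> * (\<integral>\<^sup>+x. (bump m k x)\<^sup>2 \<partial>P)"
    by (simp add: nn_integral_add nn_integral_cmult emeasure_space_1)
  also have "\<dots> \<le> 1 + ennreal \<kappa> * ennreal (B / real m ^ 4)"
    by (intro add_left_mono mult_left_mono nn_integral_bump_sq m) auto
  also have "\<dots> = ennreal (1 + \<kappa> * (B / real m ^ 4))"
    using \<kappa> B_nonneg by (subst ennreal_plus) (simp_all add: ennreal_mult[symmetric])
  finally have "(\<integral>\<^sup>+x. exp ((bump m k x)\<^sup>2 / \<sigma>\<^sup>2) \<partial>P) ^ n \<le> ennreal (1 + \<kappa> * (B / real m ^ 4)) ^ n"
    by (rule power_mono) simp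
  also have "\<dots> = ennreal ((1 + \<kappa> * (B / real m ^ 4)) ^ n)"
    using \<kappa> B_nonneg by (intro ennreal_power) auto
  also have "(1 + \<kappa> * (B / real m ^ 4)) ^ n \<le> exp (\<kappa> * (B / real m ^ 4)) ^ n"
    using \<kappa> B_nonneg by (intro power_mono exp_ge_add_one_self) auto
  also have "\<dots> = exp (real n * (\<kappa> * (B / real m ^ 4)))"
    by (rule exp_of_nat_mult[symmetric])
  also have "real n * (\<kappa> * (B / real m ^ 4)) \<le> real m ^ 4 * (\<kappa> * (B / real m ^ 4))"
    using n \<kappa> B_nonneg by (intro mult_right_mono) auto
  also have "real m ^ 4 * (\<kappa> * (B / real m ^ 4)) = \<kappa> * B"
    using m by simp
  finally show ?thesis
    by (simp add: lr_moment_bound_def \<kappa>_def ennreal_leI)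
qed

text \<open>If no bump is active at x, the left side is 0. Otherwise let \<open>k\<close> be the
  active one and pair each S without \<open>k\<close> with \<open>insert k S\<close>. The two maps
  differ by \<open>bump m k\<close>, so their data laws are close while their values at x are
  separated, and \<open>two_point_data_law\<close> bounds the summed error of the pair. The number
  of pairs is half of 2 ^ card K, whence the 2 in the denominator.\<close>

lemma assouad_pointwise:
  fixes T :: "(nat \<Rightarrow> (real^2) \<times> (real^2)) \<Rightarrow> real"
  assumes m: "m \<ge> 1" and n: "real n \<le> real m ^ 4"
    and T: "T \<in> borel_measurable (data_space n)"
    and K: "finite K"
  shows "ennreal (2 ^ card K * ((bumps m K x)\<^sup>2 / (2 * (1 + lr_moment_bound))))
    \<le> (\<Sum>S\<in>Pow K. \<integral>\<^sup>+D. (T D - bump_map m S x $ 1)\<^sup>2 \<partial>data_law P \<sigma> n (bump_map m S))"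
  (is "_ \<le> sum ?F (Pow K)")
proof (cases rule: bumps_cases[OF K, of m x])
  case 1
  then show ?thesis by simp
next
  case (2 k)
  define A where "A = K - {k}"
  have A: "K = insert k A" "k \<notin> A" "finite A"
    using 2 K by (auto simp: A_def)
  have step: "ennreal ((bump m k x)\<^sup>2 / (1 + lr_moment_bound)) \<le> ?F S + ?F (insert k S)" if "S \<in> Pow A" for S
  proof -
    have S: "finite S" "k \<notin> S" using that A finite_subset by auto
    have diff: "bump_map m (insert k S) y - bump_map m S y = bump m k y *\<^sub>R axis 1 1" for y
      by (simp add: bump_map_def bumps_insert[OF S] algebra_simps)
    have "norm (bump_map m (insert k S) y - bump_map m S y) = bump m k y" for y
      unfolding diff by (simp only: norm_scaleR norm_axis_1 mult_1_right real_norm_def abs_of_nonneg bump_nonneg)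
    then have "(\<integral>\<^sup>+x. exp ((norm (bump_map m (insert k S) x - bump_map m S x))\<^sup>2 / \<sigma>\<^sup>2) \<partial>P) ^ n \<le> ennreal lr_moment_bound"
      using exp_bump_bound[OF m n] by simp
    from two_point_data_law[OF measurable_bump_map measurable_bump_map T this lr_moment_bound_nonneg,
        of "bump_map m (insert k S) x $ 1" "bump_map m S x $ 1"]
    have "ennreal (((bump_map m (insert k S) x - bump_map m S x) $ 1)\<^sup>2 / (1 + lr_moment_bound)) \<le> ?F S + ?F (insert k S)"
      by simp
    then show ?thesis unfolding diff by simp
  qed
  have card: "card K = Suc (card A)"
    using A by simp
  have "2 ^ Suc (card A) * (y / (2 * U)) = 2 ^ card A * (y / U)" for y U :: real
    by simp
  then have "2 ^ card K * ((bumps m K x)\<^sup>2 / (2 * (1 + lr_moment_bound))) = 2 ^ card A * ((bump m k x)\<^sup>2 / (1 + lr_moment_bound))"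
    unfolding card 2(3) .
  also have "\<dots> = (\<Sum>S\<in>Pow A. (bump m k x)\<^sup>2 / (1 + lr_moment_bound))"
    using A(3) by (simp add: card_Pow)
  finally have "ennreal (2 ^ card K * ((bumps m K x)\<^sup>2 / (2 * (1 + lr_moment_bound)))) = (\<Sum>S\<in>Pow A. ennreal ((bump m k x)\<^sup>2 / (1 + lr_moment_bound)))"
    using lr_moment_bound_nonneg by (simp only: sum_ennreal divide_nonneg_nonneg zero_le_power2 add_nonneg_nonneg zero_le_one)
  also have "\<dots> \<le> (\<Sum>S\<in>Pow A. ?F S + ?F (insert k S))"
    by (intro sum_mono step)
  also have "\<dots> = sum ?F (Pow K)"
    using sum_Pow_insert[OF A(3,2), of ?F] A(1) by simp
  finally show ?thesis .
qed

section \<open>Integration over the design points\<close>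

lemma inverse_risk_ge:
  assumes fbar: "fbar \<in> estimators n" and f [measurable]: "f \<in> borel_measurable borel"
  shows "(\<integral>\<^sup>+x. \<integral>\<^sup>+D. (fbar D x $ 1 - f x $ 1)\<^sup>2 \<partial>data_law P \<sigma> n f \<partial>P) \<le> inverse_risk P \<sigma> c \<psi> n fbar f"
    and "(\<lambda>x. \<integral>\<^sup>+D. (fbar D x $ 1 - f x $ 1)\<^sup>2 \<partial>data_law P \<sigma> n f) \<in> borel_measurable P"
proof -
  interpret data: prob_space "data_law P \<sigma> n f" by (rule prob_space_data_law) fact
  interpret pair_sigma_finite "data_law P \<sigma> n f" P ..
  note measurable_on_design[OF f, measurable]
  have "sets (data_law P \<sigma> n f \<Otimes>\<^sub>M P) = sets (data_space n \<Otimes>\<^sub>M restrict_space borel I2)"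
    by (intro sets_pair_measure_cong sets_data_law sets_P)
  with fbar have [measurable]: "(\<lambda>z. fbar (fst z) (snd z)) \<in> borel_measurable (data_law P \<sigma> n f \<Otimes>\<^sub>M P)"
    by (simp add: estimators_def case_prod_beta' cong: measurable_cong_sets)
  have meas: "(\<lambda>(D, x). ennreal ((fbar D x $ 1 - f x $ 1)\<^sup>2)) \<in> borel_measurable (data_law P \<sigma> n f \<Otimes>\<^sub>M P)"
    unfolding case_prod_beta' by measurable
  have "(\<integral>\<^sup>+x. \<integral>\<^sup>+D. (fbar D x $ 1 - f x $ 1)\<^sup>2 \<partial>data_law P \<sigma> n f \<partial>P)
      = (\<integral>\<^sup>+D. \<integral>\<^sup>+x. (fbar D x $ 1 - f x $ 1)\<^sup>2 \<partial>P \<partial>data_law P \<sigma> n f)"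
    by (rule Fubini'[OF meas])
  \<comment> \<open>The \<open>\<psi>\<close> term and the second coordinate contribute nonnegative
    summands and are discarded. \<open>nn_integral_mono\<close> compares arbitrary integrands, so
    the quasi-inverse term may be nonmeasurable in \<open>D\<close>.\<close>
  also have "\<dots> \<le> inverse_risk P \<sigma> c \<psi> n fbar f"
    unfolding inverse_risk_def
  proof (rule nn_integral_mono)
    fix D
    have "(\<integral>\<^sup>+x. (fbar D x $ 1 - f x $ 1)\<^sup>2 \<partial>P) \<le> L2_norm_sq P (\<lambda>x. fbar D x - f x)"
      by (simp add: L2_norm_sq_def UNIV_2)
    then show "(\<integral>\<^sup>+x. (fbar D x $ 1 - f x $ 1)\<^sup>2 \<partial>P)
        \<le> L2_norm_sq P (\<lambda>x. fbar D x - f x) + ennreal (\<psi> (sqrt (enn2real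
          (L2_norm_sq P (\<lambda>y. quasi_inverse c (fbar D) y - inv_into I2 f y)))))"
      by (rule order_trans) simp
  qed
  finally show "(\<integral>\<^sup>+x. \<integral>\<^sup>+D. (fbar D x $ 1 - f x $ 1)\<^sup>2 \<partial>data_law P \<sigma> n f \<partial>P) \<le> inverse_risk P \<sigma> c \<psi> n fbar f" .
  show "(\<lambda>x. \<integral>\<^sup>+D. (fbar D x $ 1 - f x $ 1)\<^sup>2 \<partial>data_law P \<sigma> n f) \<in> borel_measurable P"
    using measurable_pair_swap[OF meas] by (intro data.borel_measurable_nn_integral) simp
qed

text \<open>The pointwise bound is integrated over the region where the bumps are large, which has
  design mass at least \<open>\<delta>\<close>. The sum of the risks over all 2 ^ card K maps is at
  most that many times the supremum.\<close>

lemma sup_risk_ge: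
  assumes m: "m \<ge> 1" and n: "real n \<le> real m ^ 4"
    and fbar: "fbar \<in> estimators n"
    and \<delta>: "0 \<le> \<delta>" "ennreal \<delta> \<le> emeasure P {x \<in> I2. 1 / (4 * real m) \<le> bumps m ({..<m} \<times> {..<m}) x}"
  shows "ennreal (\<delta> / (32 * (1 + lr_moment_bound) * real m ^ 2)) \<le> (SUP f\<in>F_INV. inverse_risk P \<sigma> c \<psi> n fbar f)"
proof -
  let ?K = "{..<m} \<times> {..<m}"
  let ?R = "inverse_risk P \<sigma> c \<psi> n fbar"
  let ?F = "\<lambda>S x. \<integral>\<^sup>+D. (fbar D x $ 1 - bump_map m S x $ 1)\<^sup>2 \<partial>data_law P \<sigma> n (bump_map m S)"
  let ?A = "{x \<in> I2. 1 / (4 * real m) \<le> bumps m ?K x}"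
  define w where "w = 2 ^ card ?K * ((1 / (4 * real m))\<^sup>2 / (2 * (1 + lr_moment_bound)))"
  have w: "0 \<le> w" using lr_moment_bound_nonneg by (simp add: w_def)
  have A [measurable]: "?A \<in> sets P"
    unfolding sets_P by (auto simp: sets_restrict_space image_iff intro!: bexI[of _ ?A])
  have T: "(\<lambda>D. fbar D x $ 1) \<in> borel_measurable (data_space n)" if "x \<in> I2" for x
  proof -
    have "x \<in> space (restrict_space borel I2)" using that by (simp add: space_restrict_space)
    from measurable_compose[OF measurable_Pair2'[OF this], of "\<lambda>(D, x). fbar D x" "data_space n" borel]
    have [measurable]: "(\<lambda>D. fbar D x) \<in> borel_measurable (data_space n)"
      using fbar by (simp add: estimators_def)
    show ?thesis by measurable
  qed
  have "ennreal (w * \<delta>) \<le> ennreal w * emeasure P ?A"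
    using w \<delta> by (simp add: ennreal_mult mult_left_mono)
  also have "\<dots> = (\<integral>\<^sup>+x. ennreal w * indicator ?A x \<partial>P)"
    by (rule nn_integral_cmult_indicator[symmetric]) measurable
  also have "\<dots> \<le> (\<integral>\<^sup>+x. (\<Sum>S\<in>Pow ?K. ?F S x) \<partial>P)"
  proof (rule nn_integral_mono)
    fix x assume "x \<in> space P"
    then have x: "x \<in> I2" by (simp add: space_P)
    show "ennreal w * indicator ?A x \<le> (\<Sum>S\<in>Pow ?K. ?F S x)"
    proof (cases "x \<in> ?A")
      case True
      then have "(1 / (4 * real m))\<^sup>2 \<le> (bumps m ?K x)\<^sup>2"
        by (intro power_mono) auto
      then have "w \<le> 2 ^ card ?K * ((bumps m ?K x)\<^sup>2 / (2 * (1 + lr_moment_bound)))"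
        unfolding w_def using lr_moment_bound_nonneg by (intro mult_left_mono divide_right_mono) auto
      then have "ennreal w \<le> ennreal (2 ^ card ?K * ((bumps m ?K x)\<^sup>2 / (2 * (1 + lr_moment_bound))))"
        by (rule ennreal_leI)
      also have "\<dots> \<le> (\<Sum>S\<in>Pow ?K. ?F S x)"
        by (rule assouad_pointwise[OF m n T[OF x]]) simp
      finally show ?thesis using True by simp
    qed simp
  qed
  also have "\<dots> = (\<Sum>S\<in>Pow ?K. \<integral>\<^sup>+x. ?F S x \<partial>P)"
    by (intro nn_integral_sum inverse_risk_ge(2)[OF fbar] measurable_bump_map)
  also have "\<dots> \<le> (\<Sum>S\<in>Pow ?K. (SUP f\<in>F_INV. ?R f))"
  proof (rule sum_mono)
    fix S assume "S \<in> Pow ?K"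
    then have "?R (bump_map m S) \<le> (SUP f\<in>F_INV. ?R f)"
      by (intro SUP_upper bump_map_in_F_INV) simp
    with inverse_risk_ge(1)[OF fbar measurable_bump_map]
    show "(\<integral>\<^sup>+x. ?F S x \<partial>P) \<le> (SUP f\<in>F_INV. ?R f)"
      by (rule order_trans)
  qed
  also have "\<dots> = ennreal (2 ^ card ?K) * (SUP f\<in>F_INV. ?R f)"
    by (simp only: sum_constant card_Pow finite_cartesian_product finite_lessThan
        ennreal_of_nat_eq_real_of_nat of_nat_power of_nat_numeral)
  finally have "ennreal (2 ^ card ?K) * ennreal (\<delta> / (32 * (1 + lr_moment_bound) * real m ^ 2))
      \<le> ennreal (2 ^ card ?K) * (SUP f\<in>F_INV. ?R f)"
  proof (rule order_trans[rotated])
    have "2 ^ card ?K * (\<delta> / (32 * (1 + lr_moment_bound) * real m ^ 2)) = w * \<delta>"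
      by (simp add: w_def power2_eq_square)
    then show "ennreal (2 ^ card ?K) * ennreal (\<delta> / (32 * (1 + lr_moment_bound) * real m ^ 2)) \<le> ennreal (w * \<delta>)"
      by (simp add: ennreal_mult''[symmetric] ennreal_mult'[symmetric])
  qed
  then show ?thesis
    by (subst (asm) ennreal_mult_le_mult_iff) auto
qed

end

section \<open>Choice of the grid and the rate\<close>

lemma grid_size:
  assumes "n \<ge> 1"
  obtains m :: nat where "m \<ge> 1" "real n \<le> real m ^ 4" "real m ^ 2 \<le> 4 * real n powr (1/2)"
proof -
  define a where "a = real n powr (1/4)"
  have a1: "1 \<le> a" using assms by (simp add: a_def ge_one_powr_ge_zero)
  \<comment> \<open>Rounding up gives n at most m^4, which controls the likelihood ratios. As
    \<open>a\<close> is at least 1, it at most doubles \<open>a\<close>, so m^2 is at most 4 a^2 and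
    the squared bump height keeps the order n^(-1/2).\<close>
  define m where "m = nat \<lceil>a\<rceil>"
  have m: "a \<le> real m" "real m \<le> 2 * a"
  proof -
    have "real m = real_of_int \<lceil>a\<rceil>" using a1 by (simp add: m_def)
    then show "a \<le> real m" "real m \<le> 2 * a"
      using a1 of_int_ceiling_le_add_one[of a] le_of_int_ceiling[of a] by linarith+
  qed
  have a2: "a ^ 2 = real n powr (1/2)" and a4: "a ^ 4 = real n"
    using assms by (simp_all add: a_def powr_power)
  show ?thesis
  proof (rule that)
    show "m \<ge> 1" using m a1 by linarith
    show "real n \<le> real m ^ 4"
      unfolding a4[symmetric] using m a1 by (intro power_mono) auto
    have "real m ^ 2 \<le> (2 * a) ^ 2"
      using m by (intro power_mono) auto
    then show "real m ^ 2 \<le> 4 * real n powr (1/2)"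
      by (simp add: a2 power_mult_distrib)
  qed
qed

theorem corollary5:
  fixes P\<^sub>X :: "(real^2) measure" and \<sigma> :: real and c :: "real^2" and \<psi> :: "real \<Rightarrow> real"
  assumes "prob_space P\<^sub>X"
    and "positive_bounded_density P\<^sub>X"
    and "\<sigma> > 0"
    and "c \<notin> I2"
    and "\<psi> \<in> Psi"
  shows "\<exists>C>0. \<forall>n\<ge>1.
    (INF fbar\<in>estimators n. SUP f\<in>F_INV. inverse_risk P\<^sub>X \<sigma> c \<psi> n fbar f)
      \<ge> ennreal (C * real n powr (- 2 / (2 + real CARD(2))))"
proof -
  let ?L = "restrict_space lborel I2 :: (real^2) measure"
  obtain p B where p [measurable]: "p \<in> borel_measurable (restrict_space borel I2)"
    and pB: "\<And>x. x \<in> I2 \<Longrightarrow> 0 < p x \<and> p x \<le> (B::real)"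
    and P: "P\<^sub>X = density ?L (\<lambda>x. ennreal (p x))"
    using assms(2) unfolding positive_bounded_density_def by blast
  have setsL: "sets ?L = sets (restrict_space borel I2)"
    by (intro sets_restrict_space_cong) simp
  have pL [measurable]: "p \<in> borel_measurable ?L"
    using p by (simp cong: measurable_cong_sets add: setsL)
  have "0 \<in> I2" by (simp add: I2_def)
  then have B: "0 \<le> B" using pB[of 0] by linarith
  have spaceL: "space ?L = I2" by (simp add: space_restrict_space)
  have L: "emeasure ?L A = emeasure lborel A" if "A \<in> sets borel" "A \<subseteq> I2" for A
    using that I2_sets by (intro emeasure_restrict_space) auto
  have setsP: "sets P\<^sub>X = sets (restrict_space borel I2)"
    by (simp add: P setsL)
  interpret prob_space P\<^sub>X by fact
  interpret regression_design P\<^sub>X \<sigma> B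
  proof (intro regression_design.intro regression_design_axioms.intro)
    fix A :: "(real^2) set" assume A: "A \<in> sets borel"
    have AI: "A \<inter> I2 \<in> sets ?L"
      unfolding setsL using A by (auto simp: sets_restrict_space)
    have "emeasure P\<^sub>X (A \<inter> I2) = (\<integral>\<^sup>+x. ennreal (p x) * indicator (A \<inter> I2) x \<partial>?L)"
      unfolding P using AI by (intro emeasure_density) auto
    also have "\<dots> \<le> (\<integral>\<^sup>+x. ennreal B * indicator (A \<inter> I2) x \<partial>?L)"
      using pB by (intro nn_integral_mono) (auto simp: indicator_def intro: ennreal_leI)
    also have "\<dots> = ennreal B * emeasure ?L (A \<inter> I2)"
      using AI by (rule nn_integral_cmult_indicator)
    also have "\<dots> \<le> ennreal B * emeasure lborel A"
      using A I2_sets by (subst L) (auto intro!: mult_left_mono emeasure_mono)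
    finally show "emeasure P\<^sub>X (A \<inter> I2) \<le> ennreal B * emeasure lborel A" .
  qed (fact assms setsP B)+
  have "finite_measure ?L"
    using emeasure_I2_finite L[of I2] I2_sets by (intro finite_measureI) (auto simp: spaceL)
  \<comment> \<open>The threshold 1 is the area supplied by \<open>emeasure_bumps_large\<close> for
    every grid, so \<open>\<delta>\<close> is fixed before n and m.\<close>
  then obtain \<delta> where \<delta>: "0 < \<delta>"
    "\<And>A. A \<in> sets ?L \<Longrightarrow> ennreal 1 \<le> emeasure ?L A \<Longrightarrow> ennreal \<delta> \<le> emeasure P\<^sub>X A"
    using density_mass_lower_bound[of ?L p 1] pB pL unfolding P spaceL by (metis zero_less_one)
  \<comment> \<open>128 is the 32 of \<open>sup_risk_ge\<close> times the 4 of
    \<open>grid_size\<close>.\<close>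
  define C where "C = \<delta> / (128 * (1 + lr_moment_bound))"
  have V1: "0 < 1 + lr_moment_bound" using lr_moment_bound_nonneg by linarith
  have "ennreal (C * real n powr (- 2 / (2 + real CARD(2)))) \<le> (SUP f\<in>F_INV. inverse_risk P\<^sub>X \<sigma> c \<psi> n fbar f)"
    if "n \<ge> 1" "fbar \<in> estimators n" for n fbar
  proof -
    obtain m where m: "m \<ge> 1" "real n \<le> real m ^ 4" "real m ^ 2 \<le> 4 * real n powr (1/2)"
      using grid_size[OF \<open>n \<ge> 1\<close>] .
    let ?A = "{x \<in> I2. 1 / (4 * real m) \<le> bumps m ({..<m} \<times> {..<m}) x}"
    have A: "?A \<in> sets borel" by measurable
    then have "?A \<in> sets ?L"
      unfolding setsL by (auto simp: sets_restrict_space image_iff intro!: bexI[of _ ?A])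
    moreover have "ennreal 1 \<le> emeasure ?L ?A"
      using emeasure_bumps_large[OF m(1)] A by (subst L) auto
    ultimately have "ennreal \<delta> \<le> emeasure P\<^sub>X ?A" by (rule \<delta>(2))
    note risk = sup_risk_ge[OF m(1,2) that(2) less_imp_le[OF \<delta>(1)] this, of c \<psi>]
    have "real n powr (- (1/2)) = 4 / (4 * real n powr (1/2))"
      by (simp add: powr_minus_divide)
    also have "\<dots> \<le> 4 / real m ^ 2"
      using m \<open>n \<ge> 1\<close> by (intro divide_left_mono) auto
    finally have "C * real n powr (- (1/2)) \<le> C * (4 / real m ^ 2)"
      using \<delta>(1) V1 by (intro mult_left_mono) (auto simp: C_def)
    also have "C * (4 / real m ^ 2) = \<delta> / (32 * (1 + lr_moment_bound) * real m ^ 2)"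
    proof -
      have "\<delta> / (128 * U) * (4 / M) = \<delta> / (32 * U * M)" for U M :: real by simp
      then show ?thesis unfolding C_def .
    qed
    finally have "ennreal (C * real n powr (- (1/2))) \<le> ennreal (\<delta> / (32 * (1 + lr_moment_bound) * real m ^ 2))"
      by (rule ennreal_leI)
    \<comment> \<open>With \<open>CARD(2)\<close> evaluated, the exponent -2/(2 + 2) is
      -1/2.\<close>
    then show ?thesis using risk by simp
  qed
  moreover have "0 < C" using \<delta>(1) V1 by (simp add: C_def)
  ultimately show ?thesis by (blast intro: INF_greatest)
qed

end
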